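(* Let $w \in S_n$. The poset $(\boldsymbol{c}(\Lambda_w), \leq_S)$ is a distributive lattice. Furthermore, the rank-generating functions of $(\Lambda_w,\leq_L)$ and $(\boldsymbol{c}(\Lambda_w),\leq_S)$ agree: $F(\Lambda_w,q) = F(\boldsymbol{c}(\Lambda_w),q)$.
   Context: Here $n$ is a positive integer, $[n]=\{1,\ldots,n\}$, $\mathbb{N}=\{0,1,2,\ldots\}$, and $S_n$ is the symmetric group on $[n]$, with product $(uv)(k)=u(v(k))$. For $w\in S_n$, $\mathrm{Inv}(w)=\{(i,j)\in[n]\times[n] : i<j \text{ and } w(i)>w(j)\}$ and $\ell(w)=|\mathrm{Inv}(w)|$. The left weak order $\leq_L$ on $S_n$ is the (reflexive) transitive closure of the relations $v \leq_L w$ whenever $w=s_iv$ and $\ell(w)=\ell(v)+1$, where $s_i=(i\;\;i+1)$ is an adjacent transposition. It is a ranked poset with rank function $\ell$. Write $\Lambda_w=\{v\in S_n : v\leq_L w\}=[\mathrm{id},w]$, ordered by $\leq_L$. The Lehmer code of $w$ is $\boldsymbol{c}(w)=(c_1(w),\ldots,c_n(w))\in\mathbb{N}^n$, where $c_i(w)=|\{k : (i,k)\in\mathrm{Inv}(w)\}|$. The set $\boldsymbol{c}(\Lambda_w)=\{\boldsymbol{c}(v) : v\in\Lambda_w\}\subseteq\mathbb{N}^n$ is ordered by the product order $\leq_S$ of $\mathbb{N}^n$: $(x_1,\ldots,x_n)\leq_S(y_1,\ldots,y_n)$ iff $x_i\leq y_i$ for all $i\in[n]$. A poset being a lattice means that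 join and meet are given by least upper bound and greatest lower bound. A poset $P$ is ranked if there is a function $\rho:P\to\mathbb{N}$ with $\rho(x)=0$ for minimal $x\in P$ and $\rho(y)=\rho(x)+1$ whenever $y$ covers $x$. For a finite ranked poset $P$, the rank-generating function is $F(P,q)=\sum_{x\in P}q^{\rho(x)}$. (Every finite distributive lattice is ranked.) *)

theory Defs
  imports
    "HOL-Algebra.Lattice"
    "HOL-Combinatorics.Permutations"
    "HOL-Computational_Algebra.Polynomial"
begin

section \<open>Posets\<close>

locale distributive_lattice = lattice L for L (structure) +
  assumes meet_join_distrib:
    "\<lbrakk>x \<in> carrier L; y \<in> carrier L; z \<in> carrier L\<rbrakk>
      \<Longrightarrow> x \<sqinter> (y \<squnion> z) = (x \<sqinter> y) \<squnion> (x \<sqinter> z)"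

definition minimal_in :: "'a gorder \<Rightarrow> 'a \<Rightarrow> bool" where
  "minimal_in P x \<longleftrightarrow> x \<in> carrier P \<and> (\<forall>y\<in>carrier P. \<not> y \<sqsubset>\<^bsub>P\<^esub> x)"

definition covers :: "'a gorder \<Rightarrow> 'a \<Rightarrow> 'a \<Rightarrow> bool" where
  "covers P y x \<longleftrightarrow> x \<in> carrier P \<and> y \<in> carrier P \<and> x \<sqsubset>\<^bsub>P\<^esub> y \<and>
     (\<forall>z\<in>carrier P. \<not> (x \<sqsubset>\<^bsub>P\<^esub> z \<and> z \<sqsubset>\<^bsub>P\<^esub> y))"

definition is_rank_function :: "'a gorder \<Rightarrow> ('a \<Rightarrow> nat) \<Rightarrow> bool" where
  "is_rank_function P \<rho> \<longleftrightarrow>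
     (\<forall>x. minimal_in P x \<longrightarrow> \<rho> x = 0) \<and>
     (\<forall>x y. covers P y x \<longrightarrow> \<rho> y = \<rho> x + 1)"

definition ranked_poset :: "'a gorder \<Rightarrow> bool" where
  "ranked_poset P \<longleftrightarrow> partial_order P \<and> (\<exists>\<rho>. is_rank_function P \<rho>)"

text \<open>On the carrier of a finite ranked poset the rank function is unique, so the choice below
  does not matter there. For a poset that is not ranked, or is infinite, the values of
  \<open>rank_of\<close> and \<open>rank_gen_fun\<close> carry no meaning.\<close>

definition rank_of :: "'a gorder \<Rightarrow> 'a \<Rightarrow> nat" where
  "rank_of P = (SOME \<rho>. is_rank_function P \<rho>)"

definition rank_gen_fun :: "'a gorder \<Rightarrow> int poly" where
  "rank_gen_fun P = (\<Sum>x\<in>carrier P. monom 1 (rank_of P x))"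

section \<open>Permutations, left weak order and Lehmer codes\<close>

text \<open>An element of the symmetric group on \<open>{1..n}\<close> is a function \<open>w\<close> on the naturals with
  \<open>w permutes {1..n}\<close>, hence fixing everything outside \<open>{1..n}\<close>; the product is \<open>(\<circ>)\<close>.\<close>

definition Inv :: "nat \<Rightarrow> (nat \<Rightarrow> nat) \<Rightarrow> (nat \<times> nat) set" where
  "Inv n w = {(i, j). i \<in> {1..n} \<and> j \<in> {1..n} \<and> i < j \<and> w i > w j}"

definition len :: "nat \<Rightarrow> (nat \<Rightarrow> nat) \<Rightarrow> nat" where
  "len n w = card (Inv n w)"

definition left_weak_step :: "nat \<Rightarrow> (nat \<Rightarrow> nat) \<Rightarrow> (nat \<Rightarrow> nat) \<Rightarrow> bool" where
  "left_weak_step n v w \<longleftrightarrow> v permutes {1..n} \<and> w permutes {1..n} \<and>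
     (\<exists>i\<in>{1..<n}. w = transpose i (i + 1) \<circ> v) \<and> len n w = len n v + 1"

definition left_weak_le :: "nat \<Rightarrow> (nat \<Rightarrow> nat) \<Rightarrow> (nat \<Rightarrow> nat) \<Rightarrow> bool" where
  "left_weak_le n = (left_weak_step n)\<^sup>*\<^sup>*"

definition weak_interval :: "nat \<Rightarrow> (nat \<Rightarrow> nat) \<Rightarrow> (nat \<Rightarrow> nat) set" where
  "weak_interval n w = {v. v permutes {1..n} \<and> left_weak_le n v w}"

definition weak_interval_poset :: "nat \<Rightarrow> (nat \<Rightarrow> nat) \<Rightarrow> (nat \<Rightarrow> nat) gorder" where
  "weak_interval_poset n w =
     \<lparr>carrier = weak_interval n w, eq = (=), le = left_weak_le n\<rparr>"

text \<open>A vector in \<open>\<nat>\<^sup>n\<close> is a function that is \<open>0\<close> outside \<open>{1..n}\<close>. The code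
  below is of this form because \<open>Inv n w\<close> only contains pairs from \<open>{1..n}\<close>.\<close>

definition lehmer_code :: "nat \<Rightarrow> (nat \<Rightarrow> nat) \<Rightarrow> (nat \<Rightarrow> nat)" where
  "lehmer_code n w = (\<lambda>i. card {k. (i, k) \<in> Inv n w})"

definition product_le :: "nat \<Rightarrow> (nat \<Rightarrow> nat) \<Rightarrow> (nat \<Rightarrow> nat) \<Rightarrow> bool" where
  "product_le n x y \<longleftrightarrow> (\<forall>i\<in>{1..n}. x i \<le> y i)"

definition code_poset :: "nat \<Rightarrow> (nat \<Rightarrow> nat) \<Rightarrow> (nat \<Rightarrow> nat) gorder" where
  "code_poset n w =
     \<lparr>carrier = lehmer_code n ` weak_interval n w, eq = (=), le = product_le n\<rparr>"

end

theory Submission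
  imports Defs
begin

text \<open>In left weak order, \<open>v \<le> w\<close> holds iff the inversions of \<open>v\<close> are inversions of \<open>w\<close>. The
  codes of the interval below \<open>w\<close> are therefore cut out of \<open>\<nat>\<^sup>n\<close> by the bounds
  \<open>x\<^sub>i \<le> c\<^sub>i(w)\<close> and the difference constraints \<open>x\<^sub>i - x\<^sub>j \<le> |{k. i < k < j, w k < w i}|\<close>
  for the non-inversions \<open>(i, j)\<close> of \<open>w\<close>. Such a system is preserved by componentwise maximum
  and minimum. If \<open>x < y\<close> are two solutions, \<open>y\<close> can be lowered by one at the first coordinate
  where they differ, so the rank of a code is its coordinate sum. That sum is the length of the
  permutation, and the code determines the permutation.\<close>

section \<open>Rank functions of finite posets\<close>

text \<open>A maximal element of the finite nonempty set strictly below \<open>x\<close> is covered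
  by \<open>x\<close>.\<close>

lemma exists_covered_element:
  assumes "partial_order P" "finite (carrier P)" "x \<in> carrier P" "\<not> minimal_in P x"
  shows "\<exists>y. covers P x y"
proof -
  interpret partial_order P by fact
  let ?A = "{y \<in> carrier P. y \<sqsubset>\<^bsub>P\<^esub> x}"
  have "finite ?A" "?A \<noteq> {}" using assms by (auto simp: minimal_in_def)
  moreover have "transp_on ?A (lless P)"
    by (rule transp_onI) (use lless_trans in blast)
  moreover have "asymp_on ?A (lless P)"
    by (rule asymp_onI) (use lless_antisym in blast)
  ultimately obtain m where "m \<in> ?A" "\<forall>y\<in>?A. y \<noteq> m \<longrightarrow> \<not> m \<sqsubset>\<^bsub>P\<^esub> y"
    using Finite_Set.bex_max_element[of ?A "lless P"] by blast
  moreover have "\<not> m \<sqsubset>\<^bsub>P\<^esub> m" by (simp add: lless_def eq_is_equal)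
  ultimately have "covers P x m" using assms(3) by (auto simp: covers_def)
  then show ?thesis ..
qed

text \<open>Both functions drop by one along a covering pair, so descending through covers to a
  minimal element forces agreement. Any explicit rank function may therefore replace the choice in
  \<open>rank_of\<close>.\<close>

lemma is_rank_function_unique:
  assumes P: "partial_order P" "finite (carrier P)"
    and r: "is_rank_function P \<rho>" "is_rank_function P \<sigma>"
    and "x \<in> carrier P"
  shows "\<rho> x = \<sigma> x"
  using \<open>x \<in> carrier P\<close>
proof (induction "\<rho> x" arbitrary: x rule: less_induct)
  case less
  show ?case
  proof (cases "minimal_in P x")
    case True
    then show ?thesis using r by (simp add: is_rank_function_def)
  next
    case False
    then obtain y where y: "covers P x y"
      using exists_covered_element[OF P less.prems] by blast
    have "y \<in> carrier P" using y by (simp add: covers_def)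
    moreover have "\<rho> x = \<rho> y + 1" "\<sigma> x = \<sigma> y + 1"
      using r y unfolding is_rank_function_def by blast+
    ultimately show ?thesis using less.hyps[of y] by simp
  qed
qed

lemma rank_gen_fun_eq:
  assumes "partial_order P" "finite (carrier P)" "is_rank_function P \<rho>"
  shows "rank_gen_fun P = (\<Sum>x\<in>carrier P. monom 1 (\<rho> x))"
proof -
  have *: "is_rank_function P (rank_of P)"
    unfolding rank_of_def using assms(3) by (rule someI[of "is_rank_function P"])
  show ?thesis
    unfolding rank_gen_fun_def
    using is_rank_function_unique[OF assms(1,2) * assms(3)] by simp
qed

section \<open>Sublattices of the product order\<close>

abbreviation product_poset :: "nat \<Rightarrow> (nat \<Rightarrow> nat) set \<Rightarrow> (nat \<Rightarrow> nat) gorder" where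
  "product_poset n C \<equiv> \<lparr>carrier = C, eq = (=), le = product_le n\<rparr>"

text \<open>\<open>product_le n\<close> ignores coordinates outside \<open>{1..n}\<close>; vanishing
  there is what gives antisymmetry.\<close>

lemma product_poset_partial_order:
  assumes "\<And>x i. x \<in> C \<Longrightarrow> i \<notin> {1..n} \<Longrightarrow> x i = 0"
  shows "partial_order (product_poset n C)"
proof (unfold_locales, simp_all)
  fix x y assume "product_le n x y" "product_le n y x" and C: "x \<in> C" "y \<in> C"
  show "x = y"
  proof
    fix i
    show "x i = y i"
      using \<open>product_le n x y\<close> \<open>product_le n y x\<close> assms[OF C(1), of i] assms[OF C(2), of i]
      by (cases "i \<in> {1..n}") (auto simp: product_le_def intro: antisym)
  qed
qed (auto simp: product_le_def intro: order_trans)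

text \<open>Bounds are computed componentwise, so distributivity comes from that of
  \<open>min\<close> and \<open>max\<close> on the naturals.\<close>

lemma product_poset_distributive_lattice:
  assumes supp: "\<And>x i. x \<in> C \<Longrightarrow> i \<notin> {1..n} \<Longrightarrow> x i = 0"
    and max_closed: "\<And>x y. x \<in> C \<Longrightarrow> y \<in> C \<Longrightarrow> (\<lambda>i. max (x i) (y i)) \<in> C"
    and min_closed: "\<And>x y. x \<in> C \<Longrightarrow> y \<in> C \<Longrightarrow> (\<lambda>i. min (x i) (y i)) \<in> C"
  shows "distributive_lattice (product_poset n C)"
proof -
  let ?P = "product_poset n C"
  interpret partial_order ?P by (rule product_poset_partial_order) (rule supp)
  have lub: "least ?P (\<lambda>i. max (x i) (y i)) (Upper ?P {x, y})" if "x \<in> C" "y \<in> C" for x y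
    using that max_closed by (auto simp: least_def Upper_def product_le_def)
  have glb: "greatest ?P (\<lambda>i. min (x i) (y i)) (Lower ?P {x, y})" if "x \<in> C" "y \<in> C" for x y
    using that min_closed by (auto simp: greatest_def Lower_def product_le_def)
  interpret lattice ?P
  proof unfold_locales
    fix x y assume "x \<in> carrier ?P" "y \<in> carrier ?P"
    then have "x \<in> C" "y \<in> C" by simp_all
    then show "\<exists>s. is_lub ?P s {x, y}" "\<exists>s. is_glb ?P s {x, y}"
      using lub glb by blast+
  qed
  \<comment> \<open>\<open>join\<close> and \<open>meet\<close> pick a bound by choice; uniqueness
    identifies it with the componentwise one.\<close>
  have join: "x \<squnion>\<^bsub>?P\<^esub> y = (\<lambda>i. max (x i) (y i))" if "x \<in> C" "y \<in> C" for x y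
    unfolding join_def sup_def
    by (rule some_equality) (use lub that least_unique in blast)+
  have meet: "x \<sqinter>\<^bsub>?P\<^esub> y = (\<lambda>i. min (x i) (y i))" if "x \<in> C" "y \<in> C" for x y
    unfolding meet_def inf_def
    by (rule some_equality) (use glb that greatest_unique in blast)+
  show ?thesis
    by unfold_locales (simp add: join meet max_closed min_closed min_max_distrib2)
qed

section \<open>Inversions and the left weak order\<close>

lemma Inv_subset: "Inv n v \<subseteq> {1..n} \<times> {1..n}"
  by (auto simp: Inv_def)

lemma finite_Inv [simp]: "finite (Inv n v)"
  by (rule finite_subset[OF Inv_subset]) simp

text \<open>No value lies strictly between \<open>i\<close> and \<open>i + 1\<close>, so exchanging
  them alters only the relative order at their own positions \<open>a\<close> and
  \<open>b\<close>.\<close>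

lemma Inv_transpose:
  assumes "inj v" "v a = i" "v b = i + 1" "a < b" "a \<in> {1..n}" "b \<in> {1..n}"
  shows "Inv n (transpose i (i + 1) \<circ> v) = insert (a, b) (Inv n v)" "(a, b) \<notin> Inv n v"
proof -
  have *: "v j = i \<longleftrightarrow> j = a" "v j = i + 1 \<longleftrightarrow> j = b" for j
    using assms injD[OF assms(1), of j a] injD[OF assms(1), of j b] by auto
  have "(j, k) \<in> Inv n (transpose i (i + 1) \<circ> v) \<longleftrightarrow> (j, k) \<in> insert (a, b) (Inv n v)" for j k
    using *[of j] *[of k] assms by (auto simp: Inv_def transpose_def)
  then show "Inv n (transpose i (i + 1) \<circ> v) = insert (a, b) (Inv n v)" by auto
  show "(a, b) \<notin> Inv n v" using assms by (simp add: Inv_def)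
qed

lemma left_weak_step_Inv_mono:
  assumes "left_weak_step n v u"
  shows "Inv n v \<subseteq> Inv n u"
proof -
  obtain i where v: "v permutes {1..n}" and i: "i \<in> {1..<n}"
    and u: "u = transpose i (i + 1) \<circ> v" and l: "len n u = len n v + 1"
    using assms by (auto simp: left_weak_step_def)
  define a b where "a = inv v i" and "b = inv v (i + 1)"
  have va: "v a = i" "v b = i + 1"
    using v by (auto simp: a_def b_def permutes_inverses)
  have mem: "a \<in> {1..n}" "b \<in> {1..n}"
    using permutes_in_image[OF v, of a] permutes_in_image[OF v, of b] i va by auto
  have inj: "inj v" using v by (rule permutes_inj)
  have "a \<noteq> b" using va by auto
  then consider "a < b" | "b < a" by linarith
  then show ?thesis
  proof cases
    case 1
    then show ?thesis using Inv_transpose[OF inj va _ mem] u by auto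
  next
    \<comment> \<open>The same swap leads back from \<open>u\<close> to \<open>v\<close> and adds
      the inversion \<open>(b, a)\<close>, so the step would lower the length, against
      \<open>l\<close>.\<close>
    case 2
    have "inj u" unfolding u by (intro inj_compose inj inj_transpose)
    moreover have "u b = i" "u a = i + 1" using va by (auto simp: u)
    moreover have "transpose i (i + 1) \<circ> u = v" unfolding u by (auto simp: fun_eq_iff)
    ultimately have "Inv n v = insert (b, a) (Inv n u)"
      using Inv_transpose(1)[of u b i a n] 2 mem by simp
    then have "len n u \<le> len n v" by (auto simp: len_def intro: card_mono)
    then show ?thesis using l by simp
  qed
qed

text \<open>Ascents everywhere give \<open>k \<le> p k\<close> for \<open>k \<le> n\<close>; since
  \<open>p\<close> preserves the sum over \<open>{1..n}\<close>, none of these inequalities is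
  strict.\<close>

lemma permutes_strict_mono_eq_id:
  fixes p :: "nat \<Rightarrow> nat"
  assumes "p permutes {1..n}" and step: "\<And>i. i \<in> {1..<n} \<Longrightarrow> p i < p (i + 1)"
  shows "p = id"
proof -
  have ge: "k \<le> p k" if "k \<le> n" for k
    using that
  proof (induction k)
    case (Suc k)
    then show ?case
    proof (cases "k = 0")
      case True
      then have "p (Suc k) \<in> {1..n}" using permutes_in_image[OF assms(1), of 1] Suc.prems by simp
      then show ?thesis using True by simp
    next
      case False
      then show ?thesis using Suc step[of k] by simp
    qed
  qed simp
  show ?thesis
  proof (rule ccontr)
    assume "p \<noteq> id"
    then obtain k where "p k \<noteq> k" by (auto simp: fun_eq_iff)
    then have "k \<in> {1..n}" using assms(1) by (auto simp: permutes_def)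
    then have "sum id {1..n} < sum p {1..n}"
      by (intro sum_strict_mono_ex1) (use ge \<open>p k \<noteq> k\<close> in \<open>auto simp: order_less_le intro!: bexI[of _ k]\<close>)
    moreover have "sum p {1..n} = sum id {1..n}"
      using sum.permute[OF assms(1), of id] by simp
    ultimately show False by simp
  qed
qed

text \<open>\<open>w \<circ> inv v\<close> is not the identity, so it has a descent at some
  \<open>i\<close>. Swapping the values \<open>i\<close> and \<open>i + 1\<close> in
  \<open>v\<close> adds a single inversion, one that \<open>w\<close> already has.\<close>

lemma exists_left_weak_step:
  assumes v: "v permutes {1..n}" and w: "w permutes {1..n}"
    and sub: "Inv n v \<subseteq> Inv n w" and ne: "v \<noteq> w"
  shows "\<exists>u. left_weak_step n v u \<and> Inv n u \<subseteq> Inv n w"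
proof -
  have p: "w \<circ> inv v permutes {1..n}"
    by (intro permutes_compose permutes_inv v w)
  have "w \<circ> inv v \<noteq> id"
  proof
    assume "w \<circ> inv v = id"
    then have "w \<circ> inv v \<circ> v = v" by simp
    then show False using ne v by (simp add: comp_assoc permutes_inv_o)
  qed
  then obtain i where i: "i \<in> {1..<n}" and "\<not> w (inv v i) < w (inv v (i + 1))"
    using permutes_strict_mono_eq_id[OF p] by auto
  define a b where "a = inv v i" and "b = inv v (i + 1)"
  have va: "v a = i" "v b = i + 1"
    using v by (auto simp: a_def b_def permutes_inverses)
  have mem: "a \<in> {1..n}" "b \<in> {1..n}"
    using permutes_in_image[OF v, of a] permutes_in_image[OF v, of b] i va by auto
  have "a \<noteq> b" using va by auto
  moreover have "\<not> w a < w b"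
    using \<open>\<not> w (inv v i) < w (inv v (i + 1))\<close> by (simp add: a_def b_def)
  ultimately have lt: "w b < w a"
    using permutes_inj[OF w] by (metis injD linorder_neqE_nat)
  have "a < b"
  proof (rule ccontr)
    assume "\<not> a < b"
    then have "(b, a) \<in> Inv n v" using va mem \<open>a \<noteq> b\<close> by (simp add: Inv_def)
    then have "(b, a) \<in> Inv n w" using sub by blast
    then show False using lt by (simp add: Inv_def)
  qed
  let ?u = "transpose i (i + 1) \<circ> v"
  note I = Inv_transpose[OF permutes_inj[OF v] va \<open>a < b\<close> mem]
  have "?u permutes {1..n}"
    by (intro permutes_compose v permutes_swap_id) (use i in auto)
  then have "left_weak_step n v ?u"
    using v i I by (auto simp: left_weak_step_def len_def)
  moreover have "Inv n ?u \<subseteq> Inv n w"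
    using I(1) sub \<open>a < b\<close> lt mem by (simp add: Inv_def[of n w])
  ultimately show ?thesis by blast
qed

lemma left_weak_le_iff_Inv_subset:
  assumes "v permutes {1..n}" "w permutes {1..n}"
  shows "left_weak_le n v w \<longleftrightarrow> Inv n v \<subseteq> Inv n w"
proof
  show "Inv n v \<subseteq> Inv n w" if "left_weak_le n v w"
    using that unfolding left_weak_le_def
    by (induction rule: rtranclp_induct) (auto dest: left_weak_step_Inv_mono)
next
  assume "Inv n v \<subseteq> Inv n w"
  then show "left_weak_le n v w" using assms(1)
  proof (induction "len n w - len n v" arbitrary: v rule: less_induct)
    case less
    show ?case
    proof (cases "v = w")
      case True
      then show ?thesis by (simp add: left_weak_le_def)
    next
      case False
      then obtain u where u: "left_weak_step n v u" "Inv n u \<subseteq> Inv n w"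
        using exists_left_weak_step less.prems assms(2) by blast
      have "len n u = len n v + 1" "u permutes {1..n}"
        using u(1) by (auto simp: left_weak_step_def)
      \<comment> \<open>This bound makes the truncated difference in the induction measure strictly
        smaller for \<open>u\<close> than for \<open>v\<close>.\<close>
      moreover have "len n u \<le> len n w"
        using u(2) by (simp add: len_def card_mono)
      ultimately have "left_weak_le n u w" using less.hyps[of u] u(2) by simp
      then show ?thesis using u(1) unfolding left_weak_le_def by simp
    qed
  qed
qed

section \<open>The weak order interval as a poset ranked by length\<close>

lemma left_weak_le_len:
  assumes "left_weak_le n v w"
  shows "v = w \<or> len n v < len n w"
  using assms unfolding left_weak_le_def
  by (induction rule: rtranclp_induct) (auto simp: left_weak_step_def)

lemma finite_weak_interval [simp]: "finite (weak_interval n w)"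
  by (rule finite_subset[OF _ finite_permutations[of "{1..n}"]]) (auto simp: weak_interval_def)

lemma weak_interval_partial_order: "partial_order (weak_interval_poset n w)"
proof (unfold_locales, simp_all add: weak_interval_poset_def)
  show "left_weak_le n x x" for x by (simp add: left_weak_le_def)
  \<comment> \<open>A nontrivial relation strictly raises the length, so it cannot hold both
    ways.\<close>
  show "x = y" if "left_weak_le n x y" "left_weak_le n y x" for x y
    using left_weak_le_len[OF that(1)] left_weak_le_len[OF that(2)] by auto
  show "left_weak_le n x z" if "left_weak_le n x y" "left_weak_le n y z" for x y z
    using that unfolding left_weak_le_def by (rule rtranclp_trans)
qed

lemma id_in_weak_interval:
  assumes "w permutes {1..n}"
  shows "id \<in> weak_interval n w"
proof -
  have "Inv n id = {}" by (auto simp: Inv_def)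
  then show ?thesis
    using left_weak_le_iff_Inv_subset[OF permutes_id assms] by (simp add: weak_interval_def permutes_id)
qed

lemma len_is_rank_function:
  assumes "w permutes {1..n}"
  shows "is_rank_function (weak_interval_poset n w) (len n)"
  unfolding is_rank_function_def
proof (intro conjI allI impI)
  fix x assume min: "minimal_in (weak_interval_poset n w) x"
  have I: "Inv n id = {}" by (auto simp: Inv_def)
  have "x permutes {1..n}"
    using min by (simp add: minimal_in_def weak_interval_poset_def weak_interval_def)
  then have "left_weak_le n id x"
    using left_weak_le_iff_Inv_subset[OF permutes_id] I by simp
  then have "x = id"
    using min id_in_weak_interval[OF assms]
    by (auto simp: minimal_in_def weak_interval_poset_def lless_def)
  then show "len n x = 0" by (simp add: len_def I)
next
  fix x y assume cov: "covers (weak_interval_poset n w) y x"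
  then have xy: "x \<in> weak_interval n w" "y \<in> weak_interval n w" "left_weak_le n x y" "x \<noteq> y"
    and no: "\<And>z. z \<in> weak_interval n w \<Longrightarrow> left_weak_le n x z \<Longrightarrow> x \<noteq> z \<Longrightarrow>
      left_weak_le n z y \<Longrightarrow> z = y"
    by (auto simp: covers_def weak_interval_poset_def lless_def)
  \<comment> \<open>The first step \<open>z\<close> of a chain from \<open>x\<close> to
    \<open>y\<close> stays in the interval, so covering forces \<open>z = y\<close>.\<close>
  obtain z where z: "left_weak_step n x z" "left_weak_le n z y"
    using xy(3,4) unfolding left_weak_le_def by (auto elim: converse_rtranclpE)
  have l: "len n z = len n x + 1" "z permutes {1..n}"
    using z(1) by (auto simp: left_weak_step_def)
  have "left_weak_le n z w"
    using z(2) xy(2) unfolding weak_interval_def left_weak_le_def by auto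
  moreover have "x \<noteq> z" using l(1) by auto
  ultimately have "z = y"
    using no[of z] z(2) l(2) r_into_rtranclp[of "left_weak_step n", OF z(1)]
    by (auto simp: weak_interval_def left_weak_le_def)
  then show "len n y = len n x + 1" using l by simp
qed

section \<open>Lehmer codes\<close>

lemma lehmer_code_eq:
  "i \<in> {1..n} \<Longrightarrow> lehmer_code n v i = card {k \<in> {i<..n}. v k < v i}"
  unfolding lehmer_code_def Inv_def by (rule arg_cong[where f = card]) auto

lemma lehmer_code_outside: "i \<notin> {1..n} \<Longrightarrow> lehmer_code n v i = 0"
  by (auto simp: lehmer_code_def Inv_def)

lemma lehmer_code_le: "lehmer_code n v i \<le> n - i"
proof -
  have "lehmer_code n v i \<le> card {i<..n}"
    unfolding lehmer_code_def by (rule card_mono) (auto simp: Inv_def)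
  then show ?thesis by simp
qed

lemma lehmer_code_mono:
  assumes "Inv n v \<subseteq> Inv n w"
  shows "lehmer_code n v i \<le> lehmer_code n w i"
  unfolding lehmer_code_def
proof (rule card_mono)
  show "finite {k. (i, k) \<in> Inv n w}"
    by (rule finite_subset[of _ "{1..n}"]) (auto simp: Inv_def)
qed (use assms in auto)

text \<open>Inversions are grouped by their left position. This matches the rank of a code with the
  rank of its permutation.\<close>

lemma sum_lehmer_code: "(\<Sum>i\<in>{1..n}. lehmer_code n v i) = len n v"
proof -
  have "Inv n v = (SIGMA i:{1..n}. {k. (i, k) \<in> Inv n v})"
    by (auto simp: Inv_def)
  moreover have "card \<dots> = (\<Sum>i\<in>{1..n}. lehmer_code n v i)"
    unfolding lehmer_code_def
    by (rule card_SigmaI) (auto intro: finite_subset[of _ "{1..n}"] simp: Inv_def)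
  ultimately show ?thesis by (simp add: len_def)
qed

text \<open>If \<open>u\<close> and \<open>v\<close> agree before position \<open>i\<close>, the values still to be placed form the same set
  \<open>S\<close> for both, and \<open>c\<^sub>i\<close> is the number of elements of \<open>S\<close> below the value at \<open>i\<close>.\<close>

lemma lehmer_code_inj:
  assumes u: "u permutes {1..n}" and v: "v permutes {1..n}"
    and eq: "\<And>i. i \<in> {1..n} \<Longrightarrow> lehmer_code n u i = lehmer_code n v i"
  shows "u = v"
proof -
  \<comment> \<open>Kept general in \<open>u'\<close> and \<open>v'\<close> so that exchanging them
    excludes both strict inequalities at \<open>i\<close>.\<close>
  have step: "\<not> v' i < u' i"
    if "u' permutes {1..n}" "v' permutes {1..n}" "i \<in> {1..n}"
      "lehmer_code n u' i = lehmer_code n v' i" "\<And>k. k < i \<Longrightarrow> u' k = v' k" for u' v' :: "nat \<Rightarrow> nat" and i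
  proof
    assume lt: "v' i < u' i"
    let ?S = "u' ` {i..n}"
    have img: "p ` {i..n} = {1..n} - p ` {1..<i}" if "p permutes {1..n}" for p
    proof -
      have "{i..n} = {1..n} - {1..<i}" using \<open>i \<in> {1..n}\<close> by auto
      then show ?thesis
        using permutes_image[OF that] image_set_diff[OF permutes_inj[OF that]] by metis
    qed
    have S: "v' ` {i..n} = ?S"
      using img that by (metis (no_types, lifting) atLeastLessThan_iff image_cong)
    have c: "lehmer_code n p i = card {s \<in> p ` {i..n}. s < p i}" if "p permutes {1..n}" for p
    proof -
      have "{s \<in> p ` {i..n}. s < p i} = p ` {k \<in> {i<..n}. p k < p i}"
        by (auto simp: order_less_le)
      then show ?thesis
        using lehmer_code_eq[OF \<open>i \<in> {1..n}\<close>] card_image[OF inj_on_subset[OF permutes_inj[OF that]]]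
        by simp
    qed
    have "{s \<in> ?S. s < v' i} \<subset> {s \<in> ?S. s < u' i}"
    proof
      show "{s \<in> ?S. s < v' i} \<subseteq> {s \<in> ?S. s < u' i}" using lt by auto
      have "v' i \<in> ?S" using S that(3) by auto
      then show "{s \<in> ?S. s < v' i} \<noteq> {s \<in> ?S. s < u' i}" using lt by auto
    qed
    then have "card {s \<in> ?S. s < v' i} < card {s \<in> ?S. s < u' i}"
      by (intro psubset_card_mono) auto
    then show False using c[OF that(1)] c[OF that(2)] S that(4) by simp
  qed
  have "u i = v i" for i
  proof (induction i rule: less_induct)
    case (less i)
    show ?case
    proof (cases "i \<in> {1..n}")
      case True
      then show ?thesis
        using step[OF u v True eq] step[OF v u True eq[symmetric]] less by fastforce
    next
      case False
      then show ?thesis using u v by (auto simp: permutes_def)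
    qed
  qed
  then show ?thesis by auto
qed

text \<open>The box of vectors bounded by \<open>n - i\<close> has \<open>fact n\<close> elements,
  as many as there are permutations, so the injective code map fills it.\<close>

lemma lehmer_code_surj:
  assumes supp: "\<And>i. i \<notin> {1..n} \<Longrightarrow> x i = 0" and le: "\<And>i. x i \<le> n - i"
  shows "\<exists>v. v permutes {1..n} \<and> lehmer_code n v = x"
proof -
  let ?S = "{v. v permutes {1..n}}"
  \<comment> \<open>Members of \<open>PiE\<close> are \<open>undefined\<close> off the index set
    while codes are 0 there, hence the restriction.\<close>
  let ?c = "\<lambda>v. restrict (lehmer_code n v) {1..n}"
  let ?B = "PiE {1..n} (\<lambda>i. {..n - i})"
  have "(\<Prod>i\<in>{1..n}. Suc (n - i)) = (\<Prod>i\<in>{1..n}. i)"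
    by (rule prod.reindex_bij_witness[where i = "\<lambda>i. Suc (n - i)" and j = "\<lambda>i. Suc (n - i)"]) auto
  then have "card ?B = fact n"
    by (simp add: card_PiE fact_prod)
  moreover have "inj_on ?c ?S"
  proof (rule inj_onI)
    fix u v assume "u \<in> ?S" "v \<in> ?S" and e: "?c u = ?c v"
    then show "u = v"
      using lehmer_code_inj[of u n v] by (metis mem_Collect_eq restrict_apply')
  qed
  then have "card (?c ` ?S) = fact n"
    by (simp add: card_image card_permutations)
  moreover have "?c ` ?S \<subseteq> ?B" using lehmer_code_le by auto
  moreover have "finite ?B" by (intro finite_PiE) auto
  ultimately have "?c ` ?S = ?B" by (intro card_subset_eq) auto
  moreover have "restrict x {1..n} \<in> ?B" using le by auto
  ultimately obtain v where v: "v permutes {1..n}" "restrict x {1..n} = ?c v" by blast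
  have "lehmer_code n v i = x i" for i
    using v(2) supp[of i] lehmer_code_outside[of i n v]
    by (cases "i \<in> {1..n}") (auto dest: fun_cong[of _ _ i])
  then show ?thesis using v(1) by auto
qed

section \<open>The codes of a weak order interval\<close>

text \<open>These are the only positions strictly between \<open>i\<close> and \<open>j\<close> that
  can count towards coordinate \<open>i\<close> of the code of a permutation below
  \<open>w\<close>.\<close>

definition code_gap :: "(nat \<Rightarrow> nat) \<Rightarrow> nat \<Rightarrow> nat \<Rightarrow> nat" where
  "code_gap w i j = card {k \<in> {i<..<j}. w k < w i}"

definition code_polytope :: "nat \<Rightarrow> (nat \<Rightarrow> nat) \<Rightarrow> (nat \<Rightarrow> nat) set" where
  "code_polytope n w = {x. (\<forall>i. i \<notin> {1..n} \<longrightarrow> x i = 0) \<and> (\<forall>i. x i \<le> lehmer_code n w i) \<and>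
     (\<forall>i\<in>{1..n}. \<forall>j\<in>{1..n}. i < j \<and> w i < w j \<longrightarrow> x i \<le> x j + code_gap w i j)}"

text \<open>If \<open>i < j\<close> and \<open>w i < w j\<close>, then also
  \<open>v i \<le> v j\<close>. A position counted at \<open>i\<close> is then either before
  \<open>j\<close>, where it forms an inversion of \<open>w\<close> too, or after \<open>j\<close>,
  where it is also counted at \<open>j\<close>.\<close>

lemma lehmer_code_in_code_polytope:
  assumes v: "v permutes {1..n}" and sub: "Inv n v \<subseteq> Inv n w"
  shows "lehmer_code n v \<in> code_polytope n w"
  unfolding code_polytope_def
proof (intro CollectI conjI allI impI ballI)
  show "lehmer_code n v i = 0" if "i \<notin> {1..n}" for i
    using that by (rule lehmer_code_outside)
  show "lehmer_code n v i \<le> lehmer_code n w i" for i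
    using sub by (rule lehmer_code_mono)
next
  fix i j assume ij: "i \<in> {1..n}" "j \<in> {1..n}" "i < j \<and> w i < w j"
  have "(i, j) \<notin> Inv n w" using ij by (simp add: Inv_def)
  then have "(i, j) \<notin> Inv n v" using sub by blast
  then have le: "v i \<le> v j" using ij by (auto simp: Inv_def)
  have "lehmer_code n v i \<le> card ({k \<in> {i<..<j}. w k < w i} \<union> {k \<in> {j<..n}. v k < v j})"
    unfolding lehmer_code_eq[OF ij(1)]
  proof (rule card_mono)
    show "{k \<in> {i<..n}. v k < v i} \<subseteq> {k \<in> {i<..<j}. w k < w i} \<union> {k \<in> {j<..n}. v k < v j}"
    proof
      fix k assume k: "k \<in> {k \<in> {i<..n}. v k < v i}"
      then have "(i, k) \<in> Inv n v" using ij by (auto simp: Inv_def)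
      then have "(i, k) \<in> Inv n w" using sub by blast
      then have "w k < w i" by (simp add: Inv_def)
      moreover have "k \<noteq> j" using k le by auto
      ultimately show "k \<in> {k \<in> {i<..<j}. w k < w i} \<union> {k \<in> {j<..n}. v k < v j}"
        using k le by auto
    qed
  qed simp
  also have "\<dots> \<le> code_gap w i j + lehmer_code n v j"
    unfolding code_gap_def lehmer_code_eq[OF ij(2)] by (rule card_Un_le)
  finally show "lehmer_code n v i \<le> lehmer_code n v j + code_gap w i j" by simp
qed

text \<open>At the largest \<open>i\<close> that starts an inversion \<open>(i, j)\<close> of \<open>v\<close> outside \<open>Inv n w\<close>, everything
  counted by \<open>code_gap w i j\<close>, by \<open>lehmer_code n v j\<close>, and \<open>j\<close> itself contribute to
  \<open>lehmer_code n v i\<close>, which breaks the constraint at \<open>(i, j)\<close>.\<close>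

lemma Inv_subset_if_in_code_polytope:
  assumes v: "v permutes {1..n}" and w: "w permutes {1..n}"
    and mem: "lehmer_code n v \<in> code_polytope n w"
  shows "Inv n v \<subseteq> Inv n w"
proof -
  have "(i, j) \<in> Inv n w" if "(i, j) \<in> Inv n v" for i j
    using that
  proof (induction "n - i" arbitrary: i j rule: less_induct)
    case less
    have ij: "i \<in> {1..n}" "j \<in> {1..n}" "i < j" "v j < v i"
      using less.prems by (auto simp: Inv_def)
    show ?case
    proof (rule ccontr)
      assume "(i, j) \<notin> Inv n w"
      then have wij: "w i < w j"
        using ij injD[OF permutes_inj[OF w], of i j] by (cases "w i = w j") (auto simp: Inv_def)
      have sub: "insert j ({k \<in> {i<..<j}. w k < w i} \<union> {k \<in> {j<..n}. v k < v j})
        \<subseteq> {k \<in> {i<..n}. v k < v i}" (is "insert j (?A \<union> ?B) \<subseteq> ?C")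
      proof -
        have "k \<in> ?C" if k: "k \<in> ?A" for k
        proof -
          \<comment> \<open>An inversion \<open>(k, j)\<close> of \<open>v\<close> would by
            induction be one of \<open>w\<close>, yet \<open>w k < w i < w j\<close>.\<close>
          have "n - k < n - i" using k ij by auto
          then have "(k, j) \<notin> Inv n v"
            using less.hyps[of k j] k ij wij by (auto simp: Inv_def)
          then have "v k \<le> v j" using k ij by (auto simp: Inv_def)
          then show ?thesis using k ij by auto
        qed
        then show ?thesis using ij by auto
      qed
      have "card (insert j (?A \<union> ?B)) = Suc (card ?A + card ?B)"
        by (subst card_insert_disjoint) (auto intro!: card_Un_disjoint)
      then have "lehmer_code n v j + code_gap w i j < lehmer_code n v i"
        using card_mono[OF _ sub] ij by (simp add: lehmer_code_eq code_gap_def)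
      then show False using mem ij wij by (fastforce simp: code_polytope_def)
    qed
  qed
  then show ?thesis by auto
qed

text \<open>A solution is at most the code of \<open>w\<close>, hence lies in the box of all codes
  and comes from some \<open>v\<close>; the difference constraints then put \<open>v\<close> below
  \<open>w\<close>.\<close>

lemma lehmer_code_image_weak_interval:
  assumes w: "w permutes {1..n}"
  shows "lehmer_code n ` weak_interval n w = code_polytope n w"
proof
  show "lehmer_code n ` weak_interval n w \<subseteq> code_polytope n w"
    using lehmer_code_in_code_polytope left_weak_le_iff_Inv_subset w
    by (auto simp: weak_interval_def)
next
  show "code_polytope n w \<subseteq> lehmer_code n ` weak_interval n w"
  proof
    fix x assume x: "x \<in> code_polytope n w"
    then have "x i \<le> n - i" for i
      using lehmer_code_le[of n w i] by (auto simp: code_polytope_def intro: order_trans)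
    then obtain v where v: "v permutes {1..n}" "lehmer_code n v = x"
      using lehmer_code_surj[of n x] x by (auto simp: code_polytope_def)
    then have "v \<in> weak_interval n w"
      using Inv_subset_if_in_code_polytope[OF _ w] left_weak_le_iff_Inv_subset[OF _ w] x
      by (auto simp: weak_interval_def)
    then show "x \<in> lehmer_code n ` weak_interval n w" using v by auto
  qed
qed

text \<open>Whichever of \<open>x i\<close> and \<open>y i\<close> is larger, its own constraint
  applies, and passing to the maximum at \<open>j\<close> only weakens the bound.\<close>

lemma code_polytope_max:
  assumes "x \<in> code_polytope n w" "y \<in> code_polytope n w"
  shows "(\<lambda>i. max (x i) (y i)) \<in> code_polytope n w"
  unfolding code_polytope_def
proof (intro CollectI conjI allI impI ballI)
  show "max (x i) (y i) = 0" if "i \<notin> {1..n}" for i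
    using assms that by (simp add: code_polytope_def)
  show "max (x i) (y i) \<le> lehmer_code n w i" for i
    using assms by (simp add: code_polytope_def)
next
  fix i j assume "i \<in> {1..n}" "j \<in> {1..n}" "i < j \<and> w i < w j"
  then have "x i \<le> x j + code_gap w i j" "y i \<le> y j + code_gap w i j"
    using assms by (simp_all add: code_polytope_def)
  then show "max (x i) (y i) \<le> max (x j) (y j) + code_gap w i j"
    by (simp add: max_def)
qed

lemma code_polytope_min:
  assumes "x \<in> code_polytope n w" "y \<in> code_polytope n w"
  shows "(\<lambda>i. min (x i) (y i)) \<in> code_polytope n w"
  unfolding code_polytope_def
proof (intro CollectI conjI allI impI ballI)
  show "min (x i) (y i) = 0" if "i \<notin> {1..n}" for i
    using assms that by (simp add: code_polytope_def)
  show "min (x i) (y i) \<le> lehmer_code n w i" for i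
    using assms by (simp add: code_polytope_def min.coboundedI1)
next
  fix i j assume "i \<in> {1..n}" "j \<in> {1..n}" "i < j \<and> w i < w j"
  then have "x i \<le> x j + code_gap w i j" "y i \<le> y j + code_gap w i j"
    using assms by (simp_all add: code_polytope_def)
  then show "min (x i) (y i) \<le> min (x j) (y j) + code_gap w i j"
    by (simp add: min_def)
qed

text \<open>The constraints on \<open>y\<close> at \<open>(i, j)\<close> with \<open>i < j\<close> are not tight for the least \<open>j\<close> with
  \<open>x j < y j\<close>, because \<open>y i = x i \<le> x j + code_gap w i j\<close>.\<close>

lemma code_polytope_decrement:
  assumes x: "x \<in> code_polytope n w" and y: "y \<in> code_polytope n w"
    and le: "product_le n x y" and ne: "x \<noteq> y"
  shows "\<exists>j\<in>{1..n}. x j < y j \<and> y(j := y j - 1) \<in> code_polytope n w"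
proof -
  have le': "x i \<le> y i" for i
    using le x by (cases "i \<in> {1..n}") (auto simp: product_le_def code_polytope_def)
  define j where "j = (LEAST j. x j < y j)"
  have "\<exists>j. x j < y j" using ne le' by (metis ext order_le_less)
  then have j: "x j < y j" unfolding j_def by (rule LeastI_ex)
  have less: "x i = y i" if "i < j" for i
    using not_less_Least[of i "\<lambda>j. x j < y j"] that le'[of i] unfolding j_def by simp
  have "j \<in> {1..n}" using j y by (auto simp: code_polytope_def)
  moreover have "y(j := y j - 1) \<in> code_polytope n w"
  proof -
    have y0: "\<And>i. i \<notin> {1..n} \<Longrightarrow> y i = 0" "\<And>i. y i \<le> lehmer_code n w i"
      and yd: "\<And>i k. i \<in> {1..n} \<Longrightarrow> k \<in> {1..n} \<Longrightarrow> i < k \<Longrightarrow> w i < w k \<Longrightarrow> y i \<le> y k + code_gap w i k"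
      using y by (auto simp: code_polytope_def)
    have xd: "\<And>i k. i \<in> {1..n} \<Longrightarrow> k \<in> {1..n} \<Longrightarrow> i < k \<Longrightarrow> w i < w k \<Longrightarrow> x i \<le> x k + code_gap w i k"
      using x by (auto simp: code_polytope_def)
    have "(y(j := y j - 1)) i \<le> (y(j := y j - 1)) k + code_gap w i k"
      if "i \<in> {1..n}" "k \<in> {1..n}" "i < k" "w i < w k" for i k
      using yd[OF that] xd[OF that] less[of i] that j by (cases "k = j"; cases "i = j") auto
    moreover have "(y(j := y j - 1)) i \<le> lehmer_code n w i" for i
      using y0(2)[of i] by auto
    ultimately show ?thesis using y0(1) by (auto simp: code_polytope_def)
  qed
  ultimately show ?thesis using j by blast
qed

text \<open>The zero vector solves the system, so it is the only minimal element. For a cover, the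
  decremented \<open>y\<close> lies above \<open>x\<close> and strictly below \<open>y\<close>, so
  it equals \<open>x\<close>.\<close>

lemma sum_is_rank_function:
  "is_rank_function (product_poset n (code_polytope n w)) (\<lambda>x. \<Sum>i\<in>{1..n}. x i)"
  unfolding is_rank_function_def
proof (intro conjI allI impI)
  fix x assume min: "minimal_in (product_poset n (code_polytope n w)) x"
  have "(\<lambda>_. 0) \<in> code_polytope n w" by (simp add: code_polytope_def)
  then have "x = (\<lambda>_. 0)"
    using min by (auto simp: minimal_in_def lless_def product_le_def)
  then show "(\<Sum>i\<in>{1..n}. x i) = 0" by simp
next
  fix x y assume cov: "covers (product_poset n (code_polytope n w)) y x"
  then have xy: "x \<in> code_polytope n w" "y \<in> code_polytope n w" "product_le n x y" "x \<noteq> y"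
    and no: "\<And>z. z \<in> code_polytope n w \<Longrightarrow> product_le n x z \<Longrightarrow> product_le n z y \<Longrightarrow> z \<noteq> y \<Longrightarrow> x = z"
    by (auto simp: covers_def lless_def)
  obtain j where j: "j \<in> {1..n}" "x j < y j" "y(j := y j - 1) \<in> code_polytope n w"
    using code_polytope_decrement[OF xy] by blast
  have "x = y(j := y j - 1)"
    by (rule no) (use j xy in \<open>auto simp: product_le_def fun_eq_iff\<close>)
  then have "(\<Sum>i\<in>{1..n}. x i) = (y j - 1) + (\<Sum>i\<in>{1..n} - {j}. y i)"
    using j(1) by (simp add: sum.remove)
  moreover have "(\<Sum>i\<in>{1..n}. y i) = y j + (\<Sum>i\<in>{1..n} - {j}. y i)"
    using j(1) by (simp add: sum.remove)
  ultimately show "(\<Sum>i\<in>{1..n}. y i) = (\<Sum>i\<in>{1..n}. x i) + 1" using j(2) by simp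
qed

theorem theorem3p4:
  fixes n :: nat and w :: "nat \<Rightarrow> nat"
  assumes "n \<ge> 1" and "w permutes {1..n}"
  shows "distributive_lattice (code_poset n w) \<and>
    ranked_poset (weak_interval_poset n w) \<and>
    ranked_poset (code_poset n w) \<and>
    rank_gen_fun (weak_interval_poset n w) = rank_gen_fun (code_poset n w)"
proof -
  note img = lehmer_code_image_weak_interval[OF assms(2)]
  have C: "code_poset n w = product_poset n (code_polytope n w)"
    by (simp add: code_poset_def img)
  have supp: "x i = 0" if "x \<in> code_polytope n w" "i \<notin> {1..n}" for x i
    using that by (simp add: code_polytope_def)
  have dl: "distributive_lattice (code_poset n w)"
    unfolding C using supp code_polytope_max code_polytope_min
    by (rule product_poset_distributive_lattice)
  have pc: "partial_order (code_poset n w)"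
    unfolding C using supp by (rule product_poset_partial_order)
  have rc: "is_rank_function (code_poset n w) (\<lambda>x. \<Sum>i\<in>{1..n}. x i)"
    unfolding C by (rule sum_is_rank_function)
  note pw = weak_interval_partial_order[of n w]
  note rw = len_is_rank_function[OF assms(2)]
  have inj: "inj_on (lehmer_code n) (weak_interval n w)"
    by (rule inj_onI) (auto simp: weak_interval_def intro: lehmer_code_inj)
  have "rank_gen_fun (code_poset n w) =
      (\<Sum>x\<in>lehmer_code n ` weak_interval n w. monom 1 (\<Sum>i\<in>{1..n}. x i))"
    by (subst rank_gen_fun_eq[OF pc _ rc]) (simp_all add: code_poset_def)
  \<comment> \<open>Injectivity of the code reindexes the sum by permutations, and coordinate sums
    become lengths.\<close>
  also have "\<dots> = (\<Sum>v\<in>weak_interval n w. monom 1 (len n v))"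
    by (simp only: sum.reindex[OF inj] o_def sum_lehmer_code)
  also have "\<dots> = rank_gen_fun (weak_interval_poset n w)"
    by (subst rank_gen_fun_eq[OF pw _ rw]) (simp_all add: weak_interval_poset_def)
  finally show ?thesis
    using dl pc rc pw rw by (auto simp: ranked_poset_def)
qed

end
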